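(* Two degenerate parabolic $\mathbb Q$-lattices are the same if and only if the degenerate triangular elliptic curves associated to them via the map $\tilde\theta$ are isomorphic.
   Context: A two-dimensional $\mathbb Q$-lattice is a pair $(\Lambda,\phi)$ with $\Lambda\subset\mathbb C$ a lattice and $\phi:\mathbb Q^2/\mathbb Z^2\to\mathbb Q\Lambda/\Lambda$ a homomorphism. Use the $\mathbb R$-basis $e_1=1$, $e_2=-i$ of $\mathbb C$, real $2\times2$ matrices acting by $\begin{pmatrix} a&b\\c&d\end{pmatrix}(xe_1+ye_2)=(ax+by)e_1+(cx+dy)e_2$, and $\Lambda_0=\mathbb Ze_1+\mathbb Ze_2$. A degenerate parabolic $\mathbb Q$-lattice is a $\mathbb Q$-lattice of the form $\Lambda=\alpha^{-1}\Lambda_0$, $\phi(x,y)=\alpha^{-1}(ye_2)$ for $x,y\in\mathbb Q/\mathbb Z$, with $\alpha=\begin{pmatrix} a&b\\0&1\end{pmatrix}$, $a>0$, $b\in\mathbb R$; such $\alpha$ is unique. For an elliptic curve $E=\mathbb C/\Lambda$, $TE=\mathrm{Hom}(\mathbb Q/\mathbb Z,E_{\rm tor})$, and a character $\chi:E\to\mathbb R/\mathbb Z$ induces $T(\chi):TE\to\mathrm{Hom}(\mathbb Q/\mathbb Z,\mathbb Q/\mathbb Z)=\hat{\mathbb Z}$. A degenerate triangular structure on $E$ is a pair $(\chi,\eta)$ of a character $\chi:E\to\mathbb R/\mathbb Z$ and an element $\eta\in TE$ with $T(\chi)(\eta)=1$. An isomorphism of degenerate triangular elliptic curves $(E,\chi,\eta)\to(E',\chi',\eta')$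 is an isomorphism of elliptic curves $j:E\to E'$ with $\chi'\circ j=\chi$ and $j\circ\eta=\eta'$. The map $\tilde\theta$ associates to a degenerate parabolic $\mathbb Q$-lattice $(\Lambda,\phi)$ the elliptic curve $E=\mathbb C/\Lambda$ with the degenerate triangular structure $(\chi,\eta)$, where $\chi=-\Im$ (well defined as $\Im(\Lambda)=\mathbb Z$) and $\eta(y)=\phi(0,y)$ for $y\in\mathbb Q/\mathbb Z$. *)

theory Defs
  imports "HOL-Complex_Analysis.Complex_Analysis" "HOL-Algebra.Coset"
begin

section \<open>Additive groups and their quotients\<close>

definition add_grp :: "'a::ab_group_add set \<Rightarrow> 'a monoid" where
  "add_grp A = \<lparr>carrier = A, monoid.mult = (+), one = 0\<rparr>"

text \<open>An element of \<open>quot A B\<close> is a coset of \<open>B\<close>, i.e. a set; \<open>cls B x\<close> is the class \<open>x + B\<close>.\<close>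

definition quot :: "'a::ab_group_add set \<Rightarrow> 'a set \<Rightarrow> 'a set monoid" where
  "quot A B = add_grp A Mod B"

definition cls :: "'a::ab_group_add set \<Rightarrow> 'a \<Rightarrow> 'a set" where
  "cls B x = B #>\<^bsub>add_grp UNIV\<^esub> x"

abbreviation QZ :: "rat set monoid" where
  "QZ \<equiv> quot UNIV \<int>"

abbreviation RZ :: "real set monoid" where
  "RZ \<equiv> quot UNIV \<int>"

abbreviation QZ2 :: "(rat \<times> rat) set monoid" where
  "QZ2 \<equiv> quot UNIV (\<int> \<times> \<int>)"

definition torsion_part :: "'a monoid \<Rightarrow> 'a monoid" where
  "torsion_part G = G\<lparr>carrier := {x \<in> carrier G. \<exists>n::nat. n > 0 \<and> x [^]\<^bsub>G\<^esub> n = \<one>\<^bsub>G\<^esub>}\<rparr>"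

definition quot_topology :: "'a::{ab_group_add, topological_space} set \<Rightarrow> 'a set topology" where
  "quot_topology B = topology (\<lambda>V. V \<subseteq> carrier (quot UNIV B) \<and> open {x. cls B x \<in> V})"

lemma cls_eq: "cls B x = (\<lambda>h. h + x) ` B"
  by (auto simp: cls_def add_grp_def r_coset_def)

lemma carrier_quot: "carrier (quot A B) = cls B ` A"
  by (auto simp: quot_def FactGroup_def RCOSETS_def cls_def add_grp_def r_coset_def)

lemma openin_quot_topology:
  "openin (quot_topology B) V \<longleftrightarrow> V \<subseteq> carrier (quot UNIV B) \<and> open {x. cls B x \<in> V}"
proof -
  have "istopology (\<lambda>V. V \<subseteq> carrier (quot UNIV B) \<and> open {x. cls B x \<in> V})"
    unfolding istopology_def
  proof (intro conjI allI impI)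
    fix S T
    assume "S \<subseteq> carrier (quot UNIV B) \<and> open {x. cls B x \<in> S}"
      and "T \<subseteq> carrier (quot UNIV B) \<and> open {x. cls B x \<in> T}"
    moreover have "{x. cls B x \<in> S \<inter> T} = {x. cls B x \<in> S} \<inter> {x. cls B x \<in> T}"
      by auto
    ultimately show "S \<inter> T \<subseteq> carrier (quot UNIV B)" "open {x. cls B x \<in> S \<inter> T}"
      by auto
  next
    fix K assume K: "\<forall>S\<in>K. S \<subseteq> carrier (quot UNIV B) \<and> open {x. cls B x \<in> S}"
    moreover have "{x. cls B x \<in> \<Union>K} = (\<Union>S\<in>K. {x. cls B x \<in> S})"
      by auto
    ultimately show "\<Union>K \<subseteq> carrier (quot UNIV B)" "open {x. cls B x \<in> \<Union>K}"
      by auto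
  qed
  then show ?thesis
    by (simp add: quot_topology_def)
qed


section \<open>Two-dimensional Q-lattices\<close>

definition is_lattice :: "complex set \<Rightarrow> bool" where
  "is_lattice \<Lambda> \<longleftrightarrow> (\<exists>w1 w2. w1 \<noteq> w2 \<and> independent {w1, w2} \<and>
     \<Lambda> = {of_int m * w1 + of_int n * w2 | m n. True})"

definition rat_multiples :: "complex set \<Rightarrow> complex set" where
  "rat_multiples \<Lambda> = {of_rat q * w | q w. w \<in> \<Lambda>}"

text \<open>
  A homomorphism is extended by \<open>undefined\<close> outside its domain (\<open>extensional\<close>), so that
  equality of such functions is equality of homomorphisms.
\<close>

type_synonym q_lattice = "complex set \<times> ((rat \<times> rat) set \<Rightarrow> complex set)"

definition is_q_lattice :: "q_lattice \<Rightarrow> bool" where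
  "is_q_lattice = (\<lambda>(\<Lambda>, \<phi>). is_lattice \<Lambda> \<and>
     \<phi> \<in> hom QZ2 (quot (rat_multiples \<Lambda>) \<Lambda>) \<and> \<phi> \<in> extensional (carrier QZ2))"

definition e1 :: complex where "e1 = 1"

definition e2 :: complex where "e2 = - \<i>"

definition coords :: "complex \<Rightarrow> real^2" where
  "coords z = vector [Re z, - Im z]"

definition of_coords :: "real^2 \<Rightarrow> complex" where
  "of_coords v = of_real (v $ 1) * e1 + of_real (v $ 2) * e2"

lemma of_coords_coords: "of_coords (coords z) = z"
  by (simp add: of_coords_def coords_def e1_def e2_def complex_eq_iff)

lemma coords_of_coords: "coords (of_coords v) = v"
  by (simp add: of_coords_def coords_def e1_def e2_def vec_eq_iff forall_2)

definition act :: "real^2^2 \<Rightarrow> complex \<Rightarrow> complex" where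
  "act A z = of_coords (A *v coords z)"

lemma act_eq: "act (vector [vector [a, b], vector [c, d]]) (of_real x * e1 + of_real y * e2)
    = of_real (a * x + b * y) * e1 + of_real (c * x + d * y) * e2"
  by (simp add: act_def of_coords_def coords_def e1_def e2_def matrix_vector_mult_def sum_2)

definition Lambda0 :: "complex set" where
  "Lambda0 = {of_int m * e1 + of_int n * e2 | m n. True}"

definition parabolic_matrix :: "real \<Rightarrow> real \<Rightarrow> real^2^2" where
  "parabolic_matrix a b = vector [vector [a, b], vector [0, 1]]"

definition degenerate_parabolic :: "q_lattice \<Rightarrow> bool" where
  "degenerate_parabolic = (\<lambda>(\<Lambda>, \<phi>). is_q_lattice (\<Lambda>, \<phi>) \<and>
     (\<exists>a b. a > 0 \<and>
        \<Lambda> = act (matrix_inv (parabolic_matrix a b)) ` Lambda0 \<and>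
        (\<forall>x y. \<phi> (cls (\<int> \<times> \<int>) (x, y)) =
           cls \<Lambda> (act (matrix_inv (parabolic_matrix a b)) (of_rat y * e2)))))"


section \<open>Degenerate triangular elliptic curves\<close>

text \<open>The elliptic curve \<open>\<complex>/\<Lambda>\<close> is given by the lattice \<open>\<Lambda>\<close>.\<close>

abbreviation ell :: "complex set \<Rightarrow> complex set monoid" where
  "ell \<Lambda> \<equiv> quot UNIV \<Lambda>"

text \<open>
  Holomorphy of a map between complex tori, in terms of the charts that are local inverses of the
  quotient maps: the map has a holomorphic lift near every point.
\<close>

definition holomorphic_tori ::
  "complex set \<Rightarrow> complex set \<Rightarrow> (complex set \<Rightarrow> complex set) \<Rightarrow> bool" where
  "holomorphic_tori \<Lambda> \<Lambda>' j \<longleftrightarrow>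
     (\<forall>z. \<exists>U f. open U \<and> z \<in> U \<and> f holomorphic_on U \<and> (\<forall>w\<in>U. j (cls \<Lambda> w) = cls \<Lambda>' (f w)))"

definition elliptic_iso ::
  "complex set \<Rightarrow> complex set \<Rightarrow> (complex set \<Rightarrow> complex set) \<Rightarrow> bool" where
  "elliptic_iso \<Lambda> \<Lambda>' j \<longleftrightarrow> j \<in> iso (ell \<Lambda>) (ell \<Lambda>') \<and> holomorphic_tori \<Lambda> \<Lambda>' j \<and>
     holomorphic_tori \<Lambda>' \<Lambda> (inv_into (carrier (ell \<Lambda>)) j)"

definition is_character :: "complex set \<Rightarrow> (complex set \<Rightarrow> real set) \<Rightarrow> bool" where
  "is_character \<Lambda> chi \<longleftrightarrow> chi \<in> hom (ell \<Lambda>) RZ \<and> chi \<in> extensional (carrier (ell \<Lambda>)) \<and>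
     continuous_map (quot_topology \<Lambda>) (quot_topology \<int>) chi"

definition Tate :: "complex set \<Rightarrow> (rat set \<Rightarrow> complex set) set" where
  "Tate \<Lambda> = hom QZ (torsion_part (ell \<Lambda>)) \<inter> extensional (carrier QZ)"

text \<open>
  The homomorphism induced by composition with \<open>chi\<close>.  The values \<open>chi (\<eta> y)\<close> are torsion points of
  \<open>\<real>/\<int>\<close>; the preimage under the inclusion of \<open>\<rat>\<close> in \<open>\<real>\<close> turns such a coset into the
  corresponding element of \<open>\<rat>/\<int>\<close>.
\<close>

definition T_char :: "(complex set \<Rightarrow> real set) \<Rightarrow> (rat set \<Rightarrow> complex set) \<Rightarrow> rat set \<Rightarrow> rat set"
  where "T_char chi \<eta> = (\<lambda>y\<in>carrier QZ. of_rat -` chi (\<eta> y))"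

text \<open>The unit of the ring \<open>Hom(\<rat>/\<int>, \<rat>/\<int>)\<close> of profinite integers.\<close>

definition one_Zhat :: "rat set \<Rightarrow> rat set" where
  "one_Zhat = (\<lambda>y\<in>carrier QZ. y)"

text \<open>The triple \<open>(\<Lambda>, chi, \<eta>)\<close> stands for the curve \<open>\<complex>/\<Lambda>\<close> with the structure \<open>(chi, \<eta>)\<close>.\<close>

type_synonym tri_curve = "complex set \<times> (complex set \<Rightarrow> real set) \<times> (rat set \<Rightarrow> complex set)"

definition degenerate_triangular :: "tri_curve \<Rightarrow> bool" where
  "degenerate_triangular = (\<lambda>(\<Lambda>, chi, \<eta>). is_lattice \<Lambda> \<and> is_character \<Lambda> chi \<and> \<eta> \<in> Tate \<Lambda> \<and>
     T_char chi \<eta> = one_Zhat)"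

definition tri_iso :: "tri_curve \<Rightarrow> tri_curve \<Rightarrow> (complex set \<Rightarrow> complex set) \<Rightarrow> bool" where
  "tri_iso = (\<lambda>(\<Lambda>, chi, \<eta>) (\<Lambda>', chi', \<eta>') j. elliptic_iso \<Lambda> \<Lambda>' j \<and>
     (\<forall>c\<in>carrier (ell \<Lambda>). chi' (j c) = chi c) \<and> (\<forall>y\<in>carrier QZ. j (\<eta> y) = \<eta>' y))"

definition tri_isomorphic :: "tri_curve \<Rightarrow> tri_curve \<Rightarrow> bool" where
  "tri_isomorphic X X' \<longleftrightarrow> degenerate_triangular X \<and> degenerate_triangular X' \<and> (\<exists>j. tri_iso X X' j)"

text \<open>
  For \<open>Im(\<Lambda>) = \<int>\<close>, the image of the coset \<open>z + \<Lambda>\<close> under \<open>-Im\<close> is the coset \<open>-Im z + \<int>\<close>.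
  The class of \<open>(x, y)\<close> in \<open>\<rat>\<^sup>2/\<int>\<^sup>2\<close> is the product of the classes of \<open>x\<close> and \<open>y\<close>, so
  \<open>\<int> \<times> y\<close> is the class \<open>(0, y)\<close> for \<open>y\<close> in \<open>\<rat>/\<int>\<close>.
\<close>

definition theta :: "q_lattice \<Rightarrow> tri_curve" where
  "theta = (\<lambda>(\<Lambda>, \<phi>). (\<Lambda>, (\<lambda>c\<in>carrier (ell \<Lambda>). (\<lambda>z. - Im z) ` c), (\<lambda>y\<in>carrier QZ. \<phi> (\<int> \<times> y))))"

lemma neg_Im_cls:
  assumes "Im ` \<Lambda> = \<int>"
  shows "(\<lambda>z. - Im z) ` cls \<Lambda> z = cls \<int> (- Im z)"
proof -
  have "(\<lambda>w. - Im w) ` cls \<Lambda> z = (\<lambda>t. - t + - Im z) ` (Im ` \<Lambda>)"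
    by (simp add: cls_eq image_image algebra_simps)
  also have "\<dots> = (\<lambda>t. t + - Im z) ` (uminus ` (\<int>::real set))"
    by (simp only: assms image_image)
  also have "uminus ` (\<int>::real set) = \<int>"
    by (metis (no_types) Ints_minus imageI image_subset_iff minus_minus subsetI subset_antisym)
  finally show ?thesis
    by (simp add: cls_eq)
qed

lemma cls_Times: "cls \<int> x \<times> cls \<int> y = cls (\<int> \<times> \<int>) (x :: rat, y :: rat)"
  by (force simp: cls_eq)


section \<open>Well-definedness of \<open>theta\<close>\<close>


definition add_closed :: "'a::ab_group_add set \<Rightarrow> bool" where
  "add_closed B \<longleftrightarrow> 0 \<in> B \<and> (\<forall>x\<in>B. \<forall>y\<in>B. x - y \<in> B)"

lemma add_closedD:
  assumes "add_closed B"
  shows "0 \<in> B" "x \<in> B \<Longrightarrow> y \<in> B \<Longrightarrow> x - y \<in> B" "x \<in> B \<Longrightarrow> - x \<in> B"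
    "x \<in> B \<Longrightarrow> y \<in> B \<Longrightarrow> x + y \<in> B"
proof -
  show 0: "0 \<in> B" and d: "x \<in> B \<Longrightarrow> y \<in> B \<Longrightarrow> x - y \<in> B" for x y
    using assms by (auto simp: add_closed_def)
  show m: "x \<in> B \<Longrightarrow> - x \<in> B" for x using d[OF 0, of x] by simp
  show "x \<in> B \<Longrightarrow> y \<in> B \<Longrightarrow> x + y \<in> B" using d[OF _ m, of x y] by simp
qed

lemma cls_eq_iff:
  assumes "add_closed B" shows "cls B x = cls B y \<longleftrightarrow> x - y \<in> B"
proof
  assume "cls B x = cls B y"
  then have "0 + x \<in> cls B y" using add_closedD(1)[OF assms] by (auto simp: cls_eq)
  then show "x - y \<in> B" by (auto simp: cls_eq)
next
  assume d: "x - y \<in> B"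
  show "cls B x = cls B y"
  proof (intro Set.set_eqI iffI)
    fix z assume "z \<in> cls B x"
    then obtain h where "h \<in> B" "z = h + x" by (auto simp: cls_eq)
    then have "h + (x - y) \<in> B" "z = (h + (x - y)) + y" using add_closedD(4)[OF assms _ d] by auto
    then show "z \<in> cls B y" unfolding cls_eq by blast
  next
    fix z assume "z \<in> cls B y"
    then obtain h where "h \<in> B" "z = h + y" by (auto simp: cls_eq)
    then have "h - (x - y) \<in> B" "z = (h - (x - y)) + x" using add_closedD(2)[OF assms _ d] by auto
    then show "z \<in> cls B x" unfolding cls_eq by blast
  qed
qed

lemma quot_one: "one (quot A B) = cls B 0"
  by (simp add: quot_def cls_eq)

lemma quot_mult:
  assumes "add_closed B" shows "cls B x \<otimes>\<^bsub>quot A B\<^esub> cls B y = cls B (x + y)"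
proof -
  have "cls B x \<otimes>\<^bsub>quot A B\<^esub> cls B y = {h + k | h k. h \<in> cls B x \<and> k \<in> cls B y}"
    by (auto simp: quot_def set_mult_def add_grp_def)
  also have "\<dots> = cls B (x + y)"
  proof (intro Set.set_eqI iffI)
    fix z assume "z \<in> cls B (x+y)"
    then obtain h where "h \<in> B" "z = (h + x) + (0 + y)" by (auto simp: cls_eq add.assoc)
    then show "z \<in> {h + k | h k. h \<in> cls B x \<and> k \<in> cls B y}"
      using add_closedD(1)[OF assms] unfolding cls_eq by blast
  next
    fix z assume "z \<in> {h + k | h k. h \<in> cls B x \<and> k \<in> cls B y}"
    then obtain h k where "h \<in> B" "k \<in> B" "z = (h + k) + (x + y)" by (auto simp: cls_eq algebra_simps)
    then show "z \<in> cls B (x + y)" using add_closedD(4)[OF assms] by (auto simp: cls_eq)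
  qed
  finally show ?thesis .
qed

lemma closed_Ints: "add_closed (\<int> :: 'a::ring_1 set)"
  by (auto simp: add_closed_def)

lemma quot_pow:
  assumes "add_closed B" shows "cls B x [^]\<^bsub>quot A B\<^esub> (n::nat) = cls B (((+) x ^^ n) 0)"
proof (induction n)
  case (Suc n)
  have "cls B x [^]\<^bsub>quot A B\<^esub> Suc n = cls B x [^]\<^bsub>quot A B\<^esub> n \<otimes>\<^bsub>quot A B\<^esub> cls B x"
    by (simp add: nat_pow_def)
  then show ?case
    by (simp add: Suc.IH quot_mult[OF assms] add.commute)
qed (simp add: nat_pow_def quot_one)

lemma quot_pow_complex:
  assumes "add_closed B" shows "cls B (x::complex) [^]\<^bsub>quot A B\<^esub> (n::nat) = cls B (of_nat n * x)"
proof -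
  have "((+) x ^^ n) 0 = of_nat n * x" by (induction n) (auto simp: algebra_simps)
  then show ?thesis by (simp add: quot_pow[OF assms])
qed

lemma inv_parabolic:
  assumes "a > 0"
  shows "act (matrix_inv (parabolic_matrix a b)) z = Complex (Re z / a + b * Im z / a) (Im z)"
proof -
  let ?B = "vector [vector [1/a, -b/a], vector [0, 1]] :: real^2^2"
  have 1: "parabolic_matrix a b ** ?B = mat 1" "?B ** parabolic_matrix a b = mat 1"
    using assms by (auto simp: parabolic_matrix_def vec_eq_iff forall_2 matrix_matrix_mult_def sum_2 mat_def)
  have "matrix_inv (parabolic_matrix a b) = ?B"
  proof -
    let ?A = "parabolic_matrix a b"
    have "?A ** matrix_inv ?A = mat 1 \<and> matrix_inv ?A ** ?A = mat 1"
      unfolding matrix_inv_def by (rule someI[of _ ?B]) (use 1 in auto)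
    then have inv: "matrix_inv ?A ** ?A = mat 1" by blast
    have "matrix_inv ?A = matrix_inv ?A ** (?A ** ?B)"
      by (simp only: 1 matrix_mul_rid)
    also have "\<dots> = ?B"
      by (simp only: matrix_mul_assoc inv matrix_mul_lid)
    finally show ?thesis .
  qed
  then show ?thesis
    by (simp add: act_def of_coords_def coords_def e1_def e2_def matrix_vector_mult_def sum_2
        complex_eq_iff)
qed

lemma theta_degenerate_triangular:
  assumes "degenerate_parabolic L" shows "degenerate_triangular (theta L)"
proof -
  obtain La ph where L: "L = (La, ph)" by force
  from assms obtain a b where q: "is_q_lattice (La, ph)" and a: "a > 0"
    and La: "La = act (matrix_inv (parabolic_matrix a b)) ` Lambda0"
    and ph: "\<And>x y. ph (cls (\<int> \<times> \<int>) (x, y)) = cls La (act (matrix_inv (parabolic_matrix a b)) (of_rat y * e2))"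
    by (auto simp: degenerate_parabolic_def L)
  note inv = inv_parabolic[OF a]
  define w where "w y = Complex (-b * of_rat y / a) (- of_rat y)" for y
  have ph': "ph (cls (\<int> \<times> \<int>) (x, y)) = cls La (w y)" for x y
  proof -
    have "(of_rat y :: complex) = of_real (of_rat y)" by (cases y) (simp add: of_rat_rat)
    then show ?thesis by (simp add: ph inv w_def e2_def)
  qed
  have La_eq: "La = {Complex (of_int m / a - b * of_int n / a) (- of_int n) | m n. True}"
  proof -
    have "Lambda0 = (\<lambda>(m, n). Complex (of_int m) (- of_int n)) ` UNIV"
      by (auto simp: Lambda0_def e1_def e2_def complex_eq_iff Complex_eq image_iff)
    from arg_cong[OF this, of "image (act (matrix_inv (parabolic_matrix a b)))"]
    have "La = (\<lambda>(m, n). act (matrix_inv (parabolic_matrix a b)) (Complex (of_int m) (- of_int n))) ` UNIV"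
      by (subst La) (simp only: image_image case_prod_unfold)
    also have "\<dots> = {act (matrix_inv (parabolic_matrix a b)) (Complex (of_int m) (- of_int n)) | m n. True}"
      by auto
    finally have "La = \<dots>" .
    then show ?thesis by (simp add: inv)
  qed
  have cl: "add_closed La"
    unfolding add_closed_def
  proof (intro conjI ballI)
    show "0 \<in> La" unfolding La_eq by (rule CollectI, rule exI[of _ 0], rule exI[of _ 0]) (simp add: complex_eq_iff)
    fix x y assume "x \<in> La" "y \<in> La"
    then obtain m n m' n' where "x = Complex (of_int m / a - b * of_int n / a) (- of_int n)"
      "y = Complex (of_int m' / a - b * of_int n' / a) (- of_int n')" by (auto simp: La_eq)
    then show "x - y \<in> La" unfolding La_eq
      by (intro CollectI exI[of _ "m - m'"] exI[of _ "n - n'"]) (simp add: complex_eq_iff diff_divide_distrib algebra_simps)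
  qed
  have ImLa: "Im ` La = \<int>"
  proof (intro Set.set_eqI iffI)
    fix x :: real assume "x \<in> \<int>"
    then obtain k where k: "x = of_int k" by (auto elim: Ints_cases)
    have "Complex (of_int 0 / a - b * of_int (-k) / a) (- of_int (-k)) \<in> La" unfolding La_eq by blast
    then have "Im (Complex (of_int 0 / a - b * of_int (-k) / a) (- of_int (-k))) \<in> Im ` La" by blast
    then show "x \<in> Im ` La" using k by simp
  qed (auto simp: La_eq)
  define chi where "chi = (\<lambda>c\<in>carrier (ell La). (\<lambda>z. - Im z) ` c)"
  define eta where "eta = (\<lambda>y\<in>carrier QZ. ph (\<int> \<times> y))"
  have chi: "chi (cls La z) = cls \<int> (- Im z)" for z
    by (simp add: chi_def carrier_quot neg_Im_cls[OF ImLa])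
  have eta: "eta (cls \<int> y) = cls La (w y)" for y
    using cls_Times[of 0 y] ph'[of 0 y] by (simp add: eta_def carrier_quot cls_eq)
  have th: "theta L = (La, chi, eta)" by (simp add: theta_def L chi_def eta_def)
  have char: "is_character La chi"
    unfolding is_character_def
  proof (intro conjI)
    show "chi \<in> hom (ell La) RZ"
      by (auto simp: hom_def carrier_quot chi quot_mult[OF cl] quot_mult[OF closed_Ints] algebra_simps)
    show "chi \<in> extensional (carrier (ell La))" by (simp add: chi_def)
    have top: "topspace (quot_topology B) = carrier (quot UNIV B)" for B :: "'b::{ab_group_add,topological_space} set"
    proof
      show "topspace (quot_topology B) \<subseteq> carrier (quot UNIV B)"
        using openin_topspace[of "quot_topology B"] by (simp add: openin_quot_topology del: openin_topspace)
      have "openin (quot_topology B) (carrier (quot UNIV B))" by (simp add: openin_quot_topology carrier_quot)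
      then show "carrier (quot UNIV B) \<subseteq> topspace (quot_topology B)" by (rule openin_subset)
    qed
    show "continuous_map (quot_topology La) (quot_topology \<int>) chi"
      unfolding continuous_map
    proof (intro conjI allI impI)
      show "chi ` topspace (quot_topology La) \<subseteq> topspace (quot_topology \<int>)"
        by (auto simp: top carrier_quot chi)
      fix U :: "real set set" assume "openin (quot_topology \<int>) U"
      then have "open {x. cls \<int> x \<in> U}" by (simp add: openin_quot_topology)
      then have "open ((\<lambda>z. - Im z) -` {x. cls \<int> x \<in> U})" by (intro open_vimage continuous_intros)
      moreover have "{x. cls La x \<in> {x \<in> topspace (quot_topology La). chi x \<in> U}} = (\<lambda>z. - Im z) -` {x. cls \<int> x \<in> U}"
        by (auto simp: top carrier_quot chi)
      ultimately show "openin (quot_topology La) {x \<in> topspace (quot_topology La). chi x \<in> U}"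
        by (auto simp: openin_quot_topology top)
    qed
  qed
  have wadd: "w (x + y) = w x + w y" for x y
    by (simp add: w_def complex_eq_iff of_rat_add algebra_simps add_divide_distrib diff_divide_distrib)
  have tor: "\<exists>n::nat. n > 0 \<and> cls La (w y) [^]\<^bsub>ell La\<^esub> n = \<one>\<^bsub>ell La\<^esub>" for y
  proof -
    obtain p r where y: "y = Fract p r" "r > 0" by (cases y)
    have "of_nat (nat r) * w y = Complex (of_int 0 / a - b * of_int p / a) (- of_int p)"
      using y a by (simp add: w_def complex_eq_iff of_rat_rat)
    then have "of_nat (nat r) * w y \<in> La" unfolding La_eq by blast
    then show ?thesis using y
      by (intro exI[of _ "nat r"]) (simp add: quot_pow_complex[OF cl] quot_one cls_eq_iff[OF cl])
  qed
  have "eta \<in> Tate La"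
    unfolding Tate_def
  proof
    show "eta \<in> hom QZ (torsion_part (ell La))"
      by (auto simp: hom_def carrier_quot torsion_part_def eta tor quot_mult[OF cl] quot_mult[OF closed_Ints] wadd)
    show "eta \<in> extensional (carrier QZ)" by (simp add: eta_def)
  qed
  moreover have "T_char chi eta = one_Zhat"
  proof -
    have "of_rat -` cls \<int> (of_rat y :: real) = cls \<int> y" for y
    proof (intro Set.set_eqI iffI)
      fix q assume "q \<in> of_rat -` cls \<int> (of_rat y :: real)"
      then obtain k where "of_rat q = of_int k + (of_rat y :: real)" by (auto simp: cls_eq elim!: Ints_cases)
      then have "of_rat q = (of_rat (of_int k + y) :: real)" by (simp add: of_rat_add)
      then have "q = of_int k + y" by (simp only: of_rat_eq_iff)
      then show "q \<in> cls \<int> y" by (auto simp: cls_eq)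
    qed (auto simp: cls_eq of_rat_add elim!: Ints_cases)
    then show ?thesis
      unfolding T_char_def one_Zhat_def
      by (intro restrict_ext) (clarsimp simp only: carrier_quot eta chi w_def complex.sel minus_minus)
  qed
  ultimately show ?thesis using q char by (simp add: th degenerate_triangular_def is_q_lattice_def)
qed

end

theory Submission
  imports Defs
begin

text \<open>
  Equal \<open>\<rat>\<close>-lattices have isomorphic images through the identity map, so the content is that an
  isomorphism \<open>j : \<complex>/\<Lambda> \<rightarrow> \<complex>/\<Lambda>'\<close> of degenerate triangular curves forces equality.  Near \<open>0\<close>,
  \<open>j\<close> has a holomorphic lift \<open>f\<close>, and compatibility with the characters \<open>-Im\<close> says that
  \<open>f w - w\<close> has integral imaginary part.  By the open mapping theorem such a holomorphic function
  is constant, so \<open>f\<close> is a translation, and \<open>j 0 = 0\<close> makes it a translation by an element of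
  \<open>\<Lambda>'\<close>.  Hence \<open>j (w + \<Lambda>) = w + \<Lambda>'\<close> for small \<open>w\<close>, and, since \<open>j\<close> is a homomorphism, for all
  \<open>w\<close> (\<open>tri_iso_theta_imp_cls\<close>).  Injectivity of \<open>j\<close> now gives \<open>\<Lambda> = \<Lambda>'\<close>, so \<open>j\<close> is the identity
  and preservation of \<open>\<eta>\<close> gives \<open>\<phi>(0, y) = \<phi>'(0, y)\<close>.  In a degenerate parabolic \<open>\<rat>\<close>-lattice
  \<open>\<phi>(x, y)\<close> is independent of \<open>x\<close>, whence \<open>\<phi> = \<phi>'\<close>.
\<close>

lemma is_lattice_add_closed:
  assumes "is_lattice \<Lambda>" shows "add_closed \<Lambda>"
proof -
  obtain w1 w2 where \<Lambda>: "\<Lambda> = {of_int m * w1 + of_int n * w2 | m n. True}"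
    using assms by (auto simp: is_lattice_def)
  show ?thesis
    unfolding add_closed_def
  proof (intro conjI ballI)
    show "0 \<in> \<Lambda>"
      unfolding \<Lambda> by (intro CollectI exI[of _ 0]) simp
    fix x y assume "x \<in> \<Lambda>" "y \<in> \<Lambda>"
    then obtain m n m' n' where "x = of_int m * w1 + of_int n * w2" "y = of_int m' * w1 + of_int n' * w2"
      by (auto simp: \<Lambda>)
    then show "x - y \<in> \<Lambda>"
      unfolding \<Lambda> by (intro CollectI exI[of _ "m - m'"] exI[of _ "n - n'"]) (simp add: algebra_simps)
  qed
qed

lemma degenerate_parabolic_add_closed:
  assumes "degenerate_parabolic (\<Lambda>, \<phi>)" shows "add_closed \<Lambda>"
  using assms by (auto simp: degenerate_parabolic_def is_q_lattice_def intro: is_lattice_add_closed)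

text \<open>The lower row of \<open>\<alpha>\<close> is \<open>(0, 1)\<close>, so \<open>\<alpha>\<close> and its inverse preserve imaginary parts.\<close>

lemma degenerate_parabolic_Im_image:
  assumes "degenerate_parabolic (\<Lambda>, \<phi>)" shows "Im ` \<Lambda> = \<int>"
proof -
  obtain a b where a: "a > 0" and \<Lambda>: "\<Lambda> = act (matrix_inv (parabolic_matrix a b)) ` Lambda0"
    using assms by (auto simp: degenerate_parabolic_def)
  have "Im ` \<Lambda> = Im ` Lambda0"
    by (simp add: \<Lambda> image_image inv_parabolic[OF a])
  also have "\<dots> = \<int>"
  proof (intro Set.set_eqI iffI)
    fix x :: real assume "x \<in> \<int>"
    then obtain k where "x = of_int k" by (auto elim: Ints_cases)
    then have "x = Im (of_int 0 * e1 + of_int (- k) * e2)" by (simp add: e1_def e2_def)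
    then show "x \<in> Im ` Lambda0" unfolding Lambda0_def by blast
  qed (auto simp: Lambda0_def e1_def e2_def)
  finally show ?thesis .
qed

lemma degenerate_parabolic_indep_fst:
  assumes "degenerate_parabolic (\<Lambda>, \<phi>)"
  shows "\<phi> (cls (\<int> \<times> \<int>) (x, y)) = \<phi> (cls (\<int> \<times> \<int>) (0, y))"
  using assms by (auto simp: degenerate_parabolic_def)

lemma theta_eta_cls:
  assumes "theta (\<Lambda>, \<phi>) = (\<Lambda>, chi, \<eta>)"
  shows "\<eta> (cls \<int> y) = \<phi> (cls (\<int> \<times> \<int>) (0, y))"
proof -
  have "\<int> = cls \<int> (0 :: rat)"
    by (simp add: cls_eq)
  then show ?thesis
    using assms cls_Times[of 0 y] by (auto simp: theta_def carrier_quot)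
qed

lemma theta_chi_cls:
  assumes "degenerate_parabolic (\<Lambda>, \<phi>)" and "theta (\<Lambda>, \<phi>) = (\<Lambda>, chi, \<eta>)"
  shows "chi (cls \<Lambda> z) = cls \<int> (- Im z)"
  using assms(2) neg_Im_cls[OF degenerate_parabolic_Im_image[OF assms(1)]]
  by (auto simp: theta_def carrier_quot)

text \<open>
  The points with integral imaginary part form a set with empty interior, so the open mapping
  theorem rules out nonconstant functions.
\<close>

lemma holomorphic_Im_Ints_imp_constant:
  assumes hol: "g holomorphic_on S" and S: "open S" "connected S"
    and Ints: "\<And>w. w \<in> S \<Longrightarrow> Im (g w) \<in> \<int>"
  shows "g constant_on S"
proof (rule ccontr)
  assume nc: "\<not> g constant_on S"
  then obtain w where w: "w \<in> S" by (auto simp: constant_on_def)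
  have "open (g ` S)"
    using open_mapping_thm[OF hol S S(1) _ nc] by simp
  then obtain e where e: "e > 0" "ball (g w) e \<subseteq> g ` S"
    using w by (meson imageI openE)
  define t where "t = min (e / 2) (1 / 2)"
  have t: "0 < t" "t < 1" "t < e" using e(1) by (auto simp: t_def)
  have "g w + \<i> * of_real t \<in> ball (g w) e"
    using t by (simp add: dist_norm norm_mult)
  then obtain v where "v \<in> S" "g w + \<i> * of_real t = g v"
    using e(2) by blast
  then have "Im (g w + \<i> * of_real t) \<in> \<int>"
    using Ints by simp
  then have "(Im (g w) + t) - Im (g w) \<in> \<int>"
    using Ints[OF w] by (intro Ints_diff) simp_all
  then have "t \<in> \<int>" by simp
  then show False using t by (auto elim!: Ints_cases)
qed

text \<open>
  The homomorphism property spreads the identity from a neighbourhood of \<open>0\<close> to the whole torus,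
  because every \<open>z\<close> is a multiple \<open>n w\<close> of some small \<open>w\<close>.
\<close>

lemma hom_cls_near_0_imp_cls:
  assumes cl: "add_closed \<Lambda>" and cl': "add_closed \<Lambda>'"
    and hom: "j \<in> hom (ell \<Lambda>) (ell \<Lambda>')"
    and r: "r > 0" and near: "\<And>w. w \<in> ball 0 r \<Longrightarrow> j (cls \<Lambda> w) = cls \<Lambda>' w"
  shows "j (cls \<Lambda> z) = cls \<Lambda>' z"
proof -
  have add: "j (cls \<Lambda> (x + y)) = j (cls \<Lambda> x) \<otimes>\<^bsub>ell \<Lambda>'\<^esub> j (cls \<Lambda> y)" for x y
  proof -
    have "j (cls \<Lambda> x \<otimes>\<^bsub>ell \<Lambda>\<^esub> cls \<Lambda> y) = j (cls \<Lambda> x) \<otimes>\<^bsub>ell \<Lambda>'\<^esub> j (cls \<Lambda> y)"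
      using hom by (simp add: hom_def carrier_quot)
    then show ?thesis by (simp add: quot_mult[OF cl])
  qed
  have multiple: "j (cls \<Lambda> (of_nat n * w)) = cls \<Lambda>' (of_nat n * w)" if "w \<in> ball 0 r" for n w
  proof (induction n)
    case 0
    then show ?case using near[of 0] r by simp
  next
    case (Suc n)
    then show ?case
      by (simp add: distrib_right add near[OF that] quot_mult[OF cl'])
  qed
  obtain n :: nat where n: "norm z / r < of_nat n"
    using reals_Archimedean2 by blast
  then have n0: "n > 0"
    using r by (metis divide_nonneg_pos gr0I norm_ge_zero not_less of_nat_0)
  have "z / of_nat n \<in> ball 0 r"
    using n n0 r by (simp add: norm_divide field_simps)
  from multiple[OF this, of n] show ?thesis using n0 by simp
qed

text \<open>
  An isomorphism that respects the characters \<open>-Im\<close> is induced by the identity of \<open>\<complex>\<close>: an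
  isomorphism of elliptic curves is multiplication by a complex number, and only multiplication
  by \<open>1\<close> preserves imaginary parts.  A local lift at \<open>0\<close> suffices to see this.
\<close>

lemma tri_iso_theta_imp_cls:
  assumes L: "degenerate_parabolic (\<Lambda>, \<phi>)" and L': "degenerate_parabolic (\<Lambda>', \<phi>')"
    and iso: "tri_iso (theta (\<Lambda>, \<phi>)) (theta (\<Lambda>', \<phi>')) j"
  shows "j (cls \<Lambda> z) = cls \<Lambda>' z"
proof -
  note cl = degenerate_parabolic_add_closed[OF L] and cl' = degenerate_parabolic_add_closed[OF L']
  obtain chi \<eta> chi' \<eta>' where th: "theta (\<Lambda>, \<phi>) = (\<Lambda>, chi, \<eta>)" "theta (\<Lambda>', \<phi>') = (\<Lambda>', chi', \<eta>')"
    by (simp add: theta_def)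
  have hom: "j \<in> hom (ell \<Lambda>) (ell \<Lambda>')" and hol: "holomorphic_tori \<Lambda> \<Lambda>' j"
    and chi_j: "chi' (j (cls \<Lambda> w)) = chi (cls \<Lambda> w)" for w
    using iso by (auto simp: th tri_iso_def elliptic_iso_def iso_def carrier_quot)
  obtain U f where U: "open U" "0 \<in> U" and f: "f holomorphic_on U"
    and lift: "\<And>w. w \<in> U \<Longrightarrow> j (cls \<Lambda> w) = cls \<Lambda>' (f w)"
    using hol unfolding holomorphic_tori_def by meson
  obtain r where r: "r > 0" "ball 0 r \<subseteq> U"
    using U by (meson openE)
  have "Im (f w - w) \<in> \<int>" if "w \<in> ball 0 r" for w
  proof -
    have "cls \<int> (- Im (f w)) = cls \<int> (- Im w)"
      using chi_j[of w] lift[of w] that r(2)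
      by (auto simp: theta_chi_cls[OF L th(1)]
          theta_chi_cls[OF L' th(2)])
    then have "- Im (f w) - - Im w \<in> \<int>"
      by (simp only: cls_eq_iff[OF closed_Ints])
    then show ?thesis using Ints_minus by fastforce
  qed
  moreover have "(\<lambda>w. f w - w) holomorphic_on ball 0 r"
    using f r(2) by (intro holomorphic_intros) (auto intro: holomorphic_on_subset)
  ultimately have "(\<lambda>w. f w - w) constant_on ball 0 r"
    by (intro holomorphic_Im_Ints_imp_constant) auto
  then obtain c where c: "\<And>w. w \<in> ball 0 r \<Longrightarrow> f w - w = c"
    unfolding constant_on_def by blast
  have "c \<in> \<Lambda>'"
  proof -
    \<comment> \<open>\<open>f 0 = c\<close> represents \<open>j 0\<close>, and \<open>j 0 + j 0 = j 0\<close>.\<close>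
    have j0: "j (cls \<Lambda> 0) = cls \<Lambda>' c"
      using lift[of 0] c[of 0] r(1) U(2) by simp
    have "j (cls \<Lambda> 0 \<otimes>\<^bsub>ell \<Lambda>\<^esub> cls \<Lambda> 0) = j (cls \<Lambda> 0) \<otimes>\<^bsub>ell \<Lambda>'\<^esub> j (cls \<Lambda> 0)"
      using hom by (simp add: hom_def carrier_quot)
    then have "cls \<Lambda>' c = cls \<Lambda>' (c + c)"
      by (simp add: quot_mult[OF cl] quot_mult[OF cl'] j0)
    then show ?thesis
      using add_closedD(3)[OF cl', of "- c"] by (simp add: cls_eq_iff[OF cl'])
  qed
  have "j (cls \<Lambda> w) = cls \<Lambda>' w" if "w \<in> ball 0 r" for w
  proof -
    have "j (cls \<Lambda> w) = cls \<Lambda>' (f w)" using lift that r(2) by blast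
    also have "\<dots> = cls \<Lambda>' w"
      using c[OF that] \<open>c \<in> \<Lambda>'\<close> by (simp add: cls_eq_iff[OF cl'])
    finally show ?thesis .
  qed
  then show ?thesis
    by (rule hom_cls_near_0_imp_cls[OF cl cl' hom r(1)])
qed

lemma degenerate_parabolic_eqI:
  assumes L: "degenerate_parabolic (\<Lambda>, \<phi>)" and L': "degenerate_parabolic (\<Lambda>, \<phi>')"
    and eq: "\<And>y. \<phi> (cls (\<int> \<times> \<int>) (0, y)) = \<phi>' (cls (\<int> \<times> \<int>) (0, y))"
  shows "\<phi> = \<phi>'"
proof (rule extensionalityI)
  show "\<phi> \<in> extensional (carrier QZ2)" "\<phi>' \<in> extensional (carrier QZ2)"
    using L L' by (auto simp: degenerate_parabolic_def is_q_lattice_def)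
  fix c assume "c \<in> carrier QZ2"
  then obtain x y where "c = cls (\<int> \<times> \<int>) (x, y)" by (auto simp: carrier_quot)
  then show "\<phi> c = \<phi>' c"
    using degenerate_parabolic_indep_fst[OF L, of x y] degenerate_parabolic_indep_fst[OF L', of x y] eq
    by simp
qed

lemma elliptic_iso_id: "elliptic_iso \<Lambda> \<Lambda> (\<lambda>c. c)"
proof -
  have "inv_into (carrier (ell \<Lambda>)) (\<lambda>c. c) (cls \<Lambda> w) = cls \<Lambda> w" for w
    by (rule inv_into_f_f[of "\<lambda>c. c"]) (auto simp: carrier_quot)
  then show ?thesis
    unfolding elliptic_iso_def holomorphic_tori_def
    by (auto simp: iso_def hom_def bij_betw_def
        intro!: exI[of _ UNIV] exI[of _ "\<lambda>w. w"] holomorphic_on_ident)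
qed

lemma tri_iso_id: "tri_iso X X (\<lambda>c. c)"
  by (cases X) (simp add: tri_iso_def elliptic_iso_id)

theorem proposition6p6:
  fixes L L' :: q_lattice
  assumes "degenerate_parabolic L" and "degenerate_parabolic L'"
  shows "L = L' \<longleftrightarrow> tri_isomorphic (theta L) (theta L')"
proof
  assume "L = L'"
  then show "tri_isomorphic (theta L) (theta L')"
    using theta_degenerate_triangular[OF assms(1)] tri_iso_id[of "theta L"] by (auto simp: tri_isomorphic_def)
next
  assume "tri_isomorphic (theta L) (theta L')"
  then obtain j where iso: "tri_iso (theta L) (theta L') j"
    by (auto simp: tri_isomorphic_def)
  obtain \<Lambda> \<phi> \<Lambda>' \<phi>' where eqs: "L = (\<Lambda>, \<phi>)" "L' = (\<Lambda>', \<phi>')" by force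
  note L = assms(1)[unfolded eqs] and L' = assms(2)[unfolded eqs]
  obtain chi \<eta> chi' \<eta>' where th: "theta (\<Lambda>, \<phi>) = (\<Lambda>, chi, \<eta>)" "theta (\<Lambda>', \<phi>') = (\<Lambda>', chi', \<eta>')"
    by (simp add: theta_def)
  note cl = degenerate_parabolic_add_closed[OF L] and cl' = degenerate_parabolic_add_closed[OF L']
  have j: "j (cls \<Lambda> z) = cls \<Lambda>' z" for z
    by (rule tri_iso_theta_imp_cls[OF L L' iso[unfolded eqs]])
  have inj: "inj_on j (carrier (ell \<Lambda>))" and j_\<eta>: "j (\<eta> (cls \<int> y)) = \<eta>' (cls \<int> y)" for y
    using iso by (auto simp: eqs th tri_iso_def elliptic_iso_def iso_def bij_betw_def carrier_quot)
  have "z \<in> \<Lambda> \<longleftrightarrow> z \<in> \<Lambda>'" for z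
  proof -
    have "cls \<Lambda> z = cls \<Lambda> 0 \<longleftrightarrow> cls \<Lambda>' z = cls \<Lambda>' 0"
      using inj_on_eq_iff[OF inj, of "cls \<Lambda> z" "cls \<Lambda> 0"] by (simp add: carrier_quot j)
    then show ?thesis by (simp add: cls_eq_iff[OF cl] cls_eq_iff[OF cl'])
  qed
  then have \<Lambda>: "\<Lambda>' = \<Lambda>" by blast
  have "\<phi> = \<phi>'"
  proof (rule degenerate_parabolic_eqI[OF L L'[unfolded \<Lambda>]])
    fix y
    have "\<eta> (cls \<int> y) \<in> carrier (ell \<Lambda>)"
      using theta_degenerate_triangular[OF L]
      by (auto simp: th degenerate_triangular_def Tate_def hom_def torsion_part_def carrier_quot)
    then have "j (\<eta> (cls \<int> y)) = \<eta> (cls \<int> y)"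
      using j by (auto simp: carrier_quot \<Lambda>)
    then show "\<phi> (cls (\<int> \<times> \<int>) (0, y)) = \<phi>' (cls (\<int> \<times> \<int>) (0, y))"
      using j_\<eta>[of y] by (simp add: theta_eta_cls[OF th(1)]
          theta_eta_cls[OF th(2)])
  qed
  then show "L = L'" by (simp add: eqs \<Lambda>)
qed

end
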